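(* Let $\lambda,\mu\in\mathbb{C}$ and $0<x<1$. Then $$P_{\lambda-\mu}^{-\mu}(x)=\frac{2^{3\mu}\,\Gamma\left(\mu+\frac12\right)}{\sqrt{\pi}\,(1-x^2)^{\frac\mu2}}\sum_{n=0}^{\infty}\frac{(-1)^n(2\mu-\lambda)_{2n}\,(2\mu)_n}{n!}\,P_\lambda^{-2\mu-2n}(x).$$
   Context: For $x\in(-1,1)$ and $\nu,\mu\in\mathbb{C}$ the Ferrers function of the first kind is $P_\nu^{-\mu}(x)=\left(\frac{1-x}{1+x}\right)^{\mu/2}\frac{F(-\nu,\nu+1;1+\mu;\frac{1-x}{2})}{\Gamma(1+\mu)}$, where $F$ is the Gauss hypergeometric function and $F(a,b;c;z)/\Gamma(c)$ is read as $\sum_k \frac{(a)_k(b)_k}{\Gamma(c+k)k!}z^k$, entire in $c$; it is entire in each of $\nu,\mu$. $(a)_n=\Gamma(a+n)/\Gamma(a)$. *)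

theory Defs
  imports "HOL-Analysis.Analysis"
begin

text \<open>
  The Gauss hypergeometric function divided by \<open>\<Gamma>(c)\<close>. Using \<^const>\<open>rGamma\<close>, which is
  entire and vanishes at the poles of \<^const>\<open>Gamma\<close>, makes this meaningful for every \<open>c\<close>,
  including \<open>c = 0, -1, -2, \<dots>\<close>. The series is meant for \<open>\<bar>z\<bar> < 1\<close>.
\<close>

definition hypergeo_reg :: "complex \<Rightarrow> complex \<Rightarrow> complex \<Rightarrow> complex \<Rightarrow> complex" where
  "hypergeo_reg a b c z =
     (\<Sum>k. pochhammer a k * pochhammer b k * rGamma (c + of_nat k) / fact k * z ^ k)"

text \<open>
  The Ferrers function of the first kind on \<open>-1 < x < 1\<close>. The second argument is the upper
  index, so \<open>P\<^sub>\<nu>\<close> with upper index \<open>-\<mu>\<close> is \<open>ferrers_P \<nu> (-\<mu>) x\<close>. The base of the power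
  is a positive real there, so \<open>powr\<close> is the usual principal value.
\<close>

definition ferrers_P :: "complex \<Rightarrow> complex \<Rightarrow> real \<Rightarrow> complex" where
  "ferrers_P \<nu> m x =
     complex_of_real ((1 - x) / (1 + x)) powr (- m / 2) *
     hypergeo_reg (- \<nu>) (\<nu> + 1) (1 - m) (complex_of_real ((1 - x) / 2))"

end

theory Submission
  imports Defs
begin

text \<open>
  Put \<open>t = (1 - x) / (1 + x)\<close>, so that \<open>0 < t < 1\<close>. Pfaff's transformation turns both sides into
  hypergeometric series in \<open>-t\<close>, with a common power of \<open>(1 + x) / 2\<close> split off. On the right this
  gives a double series dominated by a geometric one in \<open>t\<close>, which can be summed along diagonals;
  the coefficient of \<open>(-t) ^ N\<close> is a terminating well-poised \<open>\<^sub>3F\<^sub>2\<close> at 1, evaluated by Dixon's theorem,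
  and the duplication formula for \<open>\<Gamma>\<close> matches it with the coefficient on the left. At the poles of
  \<open>\<Gamma> (\<mu> + 1/2)\<close> the limit follows from the continuity of the left-hand side in \<open>\<mu>\<close>.
\<close>

section \<open>Terminating sums\<close>

text \<open>Dixon's theorem for the terminating well-poised series 3F2(-m, a, c; 1 + a + m, 1 + a -
  c; 1), multiplied by (1 + a - c)_m (1 + a + m)_m. In this form it is a polynomial identity, so no
  parameter has to be excluded.\<close>

lemma dixon_terminating:
  fixes a c :: "'a::field_char_0"
  shows "(\<Sum>n\<le>m. of_nat (m choose n) * (-1) ^ n * pochhammer a n * pochhammer c n *
            pochhammer (1 + a - c + of_nat n) (m - n) * pochhammer (1 + a + of_nat m + of_nat n) (m - n))
         = 4 ^ m * pochhammer (1 + a / 2 - c) m * pochhammer ((a + 1) / 2) m"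
proof (induction m)
  case 0
  show ?case by simp
next
  case (Suc m)
  define F where "F = (\<lambda>m n. of_nat (m choose n) * (-1) ^ n * pochhammer a n * pochhammer c n *
    pochhammer (1 + a - c + of_nat n) (m - n) * pochhammer (1 + a + of_nat m + of_nat n) (m - n))"
  \<comment> \<open>\<open>r\<close> is the quotient of the right-hand sides for m + 1 and m, that
    is 4 (1 + a/2 - c + m) ((a + 1)/2 + m).\<close>
  define r where "r = (2 + a - 2 * c + 2 * of_nat m) * (a + 1 + 2 * of_nat m)"
  \<comment> \<open>Zeilberger's method: \<open>F (m + 1) n - r * F m n\<close> telescopes in \<open>n\<close>. Both are multiples of the common
    factor \<open>K\<close> below, and clearing denominators this way avoids any genericity assumption on \<open>a, c\<close>.\<close>
  define G where "G = (\<lambda>n. - (if n = 0 then 0 else of_nat (m choose (n - 1))) * (-1) ^ n *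
    pochhammer a n * pochhammer c n * pochhammer (a - c + of_nat n) (Suc m - n) *
    pochhammer (1 + a + of_nat m + of_nat n) (Suc m - n))"
  have step: "F (Suc m) n - r * F m n = G (Suc n) - G n" if le: "n \<le> m" for n
  proof -
    obtain j where m: "m = n + j"
      using le_Suc_ex[OF le] by blast
    \<comment> \<open>With \<open>Suc j\<close> in the denominator, the binomial coefficients (m
      choose n), (m+1 choose n) and (m choose n-1) become (j+1) \<beta>, (m+1) \<beta> and n
      \<beta>.\<close>
    define \<beta> :: 'a where "\<beta> = fact m / (fact n * fact (Suc j))"
    define K where "K = \<beta> * (-1) ^ n * pochhammer a n * pochhammer c n *
      pochhammer (1 + a - c + of_nat n) j * pochhammer (2 + a + of_nat m + of_nat n) j"
    let ?N = "of_nat n :: 'a" and ?J = "of_nat j :: 'a"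
    have nz: "1 + ?J \<noteq> 0" "1 + ?N \<noteq> 0"
      using of_nat_neq_0[of j, where ?'a = 'a] of_nat_neq_0[of n, where ?'a = 'a] by simp_all
    have p1: "pochhammer (1 + a + of_nat m + ?N) (Suc j) =
        (1 + a + of_nat m + ?N) * pochhammer (2 + a + of_nat m + ?N) j"
      by (subst pochhammer_rec) (simp add: algebra_simps)
    have p1': "pochhammer (1 + a + of_nat m + ?N) (Suc j) =
        pochhammer (1 + a + of_nat m + ?N) j * (1 + a + 2 * of_nat m)"
      by (subst pochhammer_Suc) (simp add: m algebra_simps)
    have p2: "pochhammer (a - c + ?N) (Suc j) = (a - c + ?N) * pochhammer (1 + a - c + ?N) j"
      by (subst pochhammer_rec) (simp add: algebra_simps)
    have b: "of_nat (m choose n) = (1 + ?J) * \<beta>"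
      using nz by (simp add: \<beta>_def m binomial_fact divide_simps del: distrib_left distrib_right)
    have rF: "r * F m n = (2 + a - 2 * c + 2 * of_nat m) * (1 + ?J) * (1 + a + of_nat m + ?N) * K"
    proof -
      have "r * F m n = (2 + a - 2 * c + 2 * of_nat m) * of_nat (m choose n) * (-1) ^ n *
          pochhammer a n * pochhammer c n * pochhammer (1 + a - c + ?N) j *
          (pochhammer (1 + a + of_nat m + ?N) j * (1 + a + 2 * of_nat m))"
        by (simp add: r_def F_def m mult_ac add_ac)
      also have "\<dots> = (2 + a - 2 * c + 2 * of_nat m) * (1 + ?J) * (1 + a + of_nat m + ?N) * K"
        unfolding p1'[symmetric] p1 b K_def by (simp only: mult_ac)
      finally show ?thesis .
    qed
    have FS: "F (Suc m) n = (1 + of_nat m) * (1 + a - c + of_nat m) * (a + 2 * of_nat m + 2) * K"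
    proof -
      have "of_nat (Suc m choose n) = (1 + of_nat m) * \<beta>"
        by (simp add: \<beta>_def m binomial_fact Suc_diff_le)
      moreover have "pochhammer (1 + a - c + ?N) (Suc j) = pochhammer (1 + a - c + ?N) j * (1 + a - c + of_nat m)"
        by (simp add: pochhammer_Suc m algebra_simps)
      moreover have "pochhammer (1 + a + of_nat (Suc m) + ?N) (Suc j) =
          pochhammer (2 + a + of_nat m + ?N) j * (a + 2 * of_nat m + 2)"
        by (simp add: pochhammer_Suc m algebra_simps)
      moreover have "Suc m - n = Suc j" by (simp add: m)
      ultimately show ?thesis unfolding F_def K_def
        by (simp only: mult_ac)
    qed
    have Gn: "G n = - ?N * (a - c + ?N) * (1 + a + of_nat m + ?N) * K"
    proof (cases n)
      case 0
      then show ?thesis by (simp add: G_def)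
    next
      case (Suc i)
      have "of_nat (m choose i) = (fact m / (fact i * fact (Suc j)) :: 'a)"
        using Suc by (simp add: m binomial_fact)
      also have "\<dots> = ?N * \<beta>"
        using Suc nz of_nat_neq_0[of i, where ?'a = 'a]
        by (simp add: \<beta>_def divide_simps)
      finally have "of_nat (m choose (n - 1)) = ?N * \<beta>"
        using Suc by simp
      moreover have "n \<noteq> 0" using Suc by simp
      moreover have "Suc m - n = Suc j" by (simp add: m)
      ultimately show ?thesis unfolding G_def K_def
        by (simp add: p1 p2 mult_ac)
    qed
    have GS: "G (Suc n) = (1 + ?J) * (a + ?N) * (c + ?N) * K"
    proof -
      have d: "Suc m - Suc n = j" by (simp add: m)
      have e: "a - c + of_nat (Suc n) = 1 + a - c + ?N"
        "1 + a + of_nat m + of_nat (Suc n) = 2 + a + of_nat m + ?N"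
        by simp_all
      show ?thesis unfolding G_def K_def d e using b
        by (simp add: pochhammer_Suc mult_ac)
    qed
    \<comment> \<open>All four terms are polynomial multiples of \<open>K\<close>, so a polynomial
      identity in a, c, n, j remains.\<close>
    show ?thesis unfolding rF FS Gn GS by (simp add: m algebra_simps)
  qed
  \<comment> \<open>The summand n = m + 1 is outside the range of \<open>step\<close>; it cancels
    the upper boundary term of the telescoping sum. The lower one is \<open>G 0 = 0\<close>, thanks
    to the case distinction in \<open>G\<close>: truncated subtraction alone would give the
    coefficient 1 there.\<close>
  have last: "F (Suc m) (Suc m) = - G (Suc m)"
    by (simp add: F_def G_def)
  have "(\<Sum>n\<le>m. F (Suc m) n) - r * (\<Sum>n\<le>m. F m n) = (\<Sum>n\<le>m. G (Suc n) - G n)"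
    using step by (simp add: sum_distrib_left flip: sum_subtractf)
  also have "\<dots> = G (Suc m)"
    using sum_lessThan_telescope[of G "Suc m"] by (simp add: lessThan_Suc_atMost G_def[of] del: sum.lessThan_Suc)
  finally have "(\<Sum>n\<le>Suc m. F (Suc m) n) = r * (\<Sum>n\<le>m. F m n)"
    using last by (simp add: algebra_simps)
  also have "(\<Sum>n\<le>m. F m n) = 4 ^ m * pochhammer (1 + a / 2 - c) m * pochhammer ((a + 1) / 2) m"
    using Suc.IH by (simp add: F_def)
  also have "r * \<dots> = 4 ^ Suc m * pochhammer (1 + a / 2 - c) (Suc m) * pochhammer ((a + 1) / 2) (Suc m)"
    by (simp add: r_def pochhammer_Suc field_simps)
  finally show ?case by (simp add: F_def)
qed

text \<open>Chu-Vandermonde for 2F1(-n, d; c; 1), multiplied by (c)_n. Reversing the factors of (c +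
  k)_(n-k) absorbs the alternating sign and leaves the binomial theorem for rising
  factorials.\<close>

lemma vandermonde_alternating:
  fixes c d :: "'a::field_char_0"
  shows "(\<Sum>k\<le>n. of_nat (n choose k) * (-1) ^ k * pochhammer d k * pochhammer (c + of_nat k) (n - k))
         = pochhammer (c - d) n"
proof -
  have "(-1) ^ k * pochhammer (c + of_nat k) (n - k) = (-1) ^ n * pochhammer (1 - c - of_nat n) (n - k)"
    if "k \<le> n" for k
  proof -
    have "pochhammer (c + of_nat k) (n - k) = (-1) ^ (n - k) * pochhammer (1 - c - of_nat n) (n - k)"
      using pochhammer_minus'[of "c + of_nat n - 1" "n - k"] that by (simp add: of_nat_diff algebra_simps)
    moreover have "(-1) ^ k * (-1) ^ (n - k) = ((-1) ^ n :: 'a)"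
      using that by (simp flip: power_add)
    ultimately show ?thesis by (metis mult.assoc)
  qed
  then have "(\<Sum>k\<le>n. of_nat (n choose k) * (-1) ^ k * pochhammer d k * pochhammer (c + of_nat k) (n - k))
      = (-1) ^ n * (\<Sum>k\<le>n. of_nat (n choose k) * pochhammer d k * pochhammer (1 - c - of_nat n) (n - k))"
    unfolding sum_distrib_left by (intro sum.cong) (simp_all add: algebra_simps)
  also have "\<dots> = (-1) ^ n * pochhammer (d + (1 - c - of_nat n)) n"
    by (simp add: pochhammer_binomial_sum)
  also have "\<dots> = pochhammer (c - d) n"
    using pochhammer_minus[of "d - c" n] by (simp add: algebra_simps)
  finally show ?thesis .
qed

section \<open>Growth of coefficients and diagonal summation\<close>

text \<open>From some \<open>N\<close> on the ratio of consecutive norms is below r, and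
  \<open>C\<close> bounds all terms up to \<open>N\<close>. Only an eventual ratio bound is assumed
  because the ratios used later may have a zero denominator at finitely many places.\<close>

lemma growth_from_ratio:
  fixes f :: "nat \<Rightarrow> 'a::real_normed_vector"
  assumes "eventually (\<lambda>n. norm (f (Suc n)) \<le> s n * norm (f n)) sequentially"
    and "s \<longlonglongrightarrow> 1" and "1 < r"
  obtains C where "0 \<le> C" "\<And>n. norm (f n) \<le> C * r ^ n"
proof -
  have "eventually (\<lambda>n. s n < r) sequentially"
    using assms(2,3) by (rule order_tendstoD)
  with assms(1) obtain N where N: "\<And>n. n \<ge> N \<Longrightarrow> norm (f (Suc n)) \<le> s n * norm (f n) \<and> s n < r"
    unfolding eventually_sequentially by (metis (full_types) linorder_not_le max.bounded_iff max_def)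
  define C where "C = (\<Sum>k\<le>N. norm (f k))"
  have le_C: "norm (f k) \<le> C" if "k \<le> N" for k
    unfolding C_def using that by (intro member_le_sum) auto
  have "norm (f n) \<le> C * r ^ n" for n
  proof (induction n)
    case 0
    show ?case using le_C[of 0] by simp
  next
    case (Suc n)
    show ?case
    proof (cases "n < N")
      case True
      have "C * 1 \<le> C * r ^ Suc n"
        using assms(3) by (intro mult_left_mono one_le_power) (auto simp: C_def sum_nonneg)
      with le_C[of "Suc n"] True show ?thesis by simp
    next
      case False
      have "norm (f (Suc n)) \<le> r * norm (f n)"
        using N[of n] False by (smt (verit) mult_right_mono norm_ge_zero not_less)
      also have "\<dots> \<le> r * (C * r ^ n)"
        using Suc assms(3) by (intro mult_left_mono) auto
      finally show ?thesis by (simp add: mult_ac)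
    qed
  qed
  moreover have "0 \<le> C" by (simp add: C_def sum_nonneg)
  ultimately show ?thesis using that by blast
qed

lemma tendsto_shift_ratio:
  fixes c d :: "'a::{real_normed_field}"
  shows "(\<lambda>n. (d + of_nat n) / (c + of_nat n)) \<longlonglongrightarrow> 1"
proof -
  have "(\<lambda>n. (d / of_nat n + 1) / (c / of_nat n + 1)) \<longlonglongrightarrow> (0 + 1) / (0 + 1)"
    by (intro tendsto_intros lim_const_over_n) auto
  moreover have "eventually (\<lambda>n. (d / of_nat n + 1) / (c / of_nat n + 1) = (d + of_nat n) / (c + of_nat n)) sequentially"
    using eventually_gt_at_top[of 0]
    by eventually_elim (simp add: divide_simps)
  ultimately show ?thesis
    by (simp add: tendsto_cong)
qed

lemma eventually_shift_nonzero:
  fixes c :: "'a::{real_normed_field}"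
  shows "eventually (\<lambda>n. c + of_nat n \<noteq> 0) sequentially"
proof -
  have "c + of_nat n \<noteq> 0" if "real n > norm c" for n
  proof
    assume "c + of_nat n = 0"
    then have "c = - of_nat n" by (simp add: eq_neg_iff_add_eq_0)
    then have "norm c = real n" by simp
    with that show False by simp
  qed
  then show ?thesis
    by (rule eventually_mono[OF eventually_gt_at_top[of "nat \<lceil>norm c\<rceil>"], rotated]) linarith
qed

text \<open>Consecutive terms have ratio (d + n)/(c + n), which tends to 1, so the growth is slower
  than any r^n with r > 1. Pairing a Pochhammer symbol with \<open>rGamma\<close> instead of
  dividing by (c)_n keeps every c admissible.\<close>

lemma pochhammer_rGamma_growth:
  fixes c d :: "'a::Gamma"
  assumes "1 < r"
  obtains C where "0 \<le> C" "\<And>n. norm (pochhammer d n * rGamma (c + of_nat n)) \<le> C * r ^ n"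
proof -
  define f where "f = (\<lambda>n. pochhammer d n * rGamma (c + of_nat n))"
  have f: "(c + of_nat n) * f (Suc n) = (d + of_nat n) * f n" for n
    using rGamma_plus1[of "c + of_nat n"] by (simp add: f_def pochhammer_Suc add_ac mult_ac)
  have ratio: "eventually (\<lambda>n. norm (f (Suc n)) \<le> norm ((d + of_nat n) / (c + of_nat n)) * norm (f n)) sequentially"
    using eventually_shift_nonzero[of c]
  proof eventually_elim
    case (elim n)
    then have "f (Suc n) = (d + of_nat n) / (c + of_nat n) * f n"
      using f[of n] by (simp add: field_simps)
    then show ?case by (simp only: norm_mult order_refl)
  qed
  have lim: "(\<lambda>n. norm ((d + of_nat n) / (c + of_nat n))) \<longlonglongrightarrow> 1"
    using tendsto_norm[OF tendsto_shift_ratio[of d c]] by simp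
  show ?thesis
    by (rule growth_from_ratio[OF ratio lim assms]) (rule that, auto simp: f_def)
qed

lemma pochhammer_fact_growth:
  fixes a :: "'a::Gamma"
  assumes "1 < r"
  obtains C where "0 \<le> C" "\<And>n. norm (pochhammer a n / fact n) \<le> C * r ^ n"
proof -
  \<comment> \<open>The factorial is the case c = 1 of the reciprocal Gamma factor.\<close>
  have "pochhammer a n / fact n = pochhammer a n * rGamma (1 + of_nat n)" for n
    by (simp add: rGamma_inverse_Gamma Gamma_fact divide_inverse)
  then show ?thesis
    using pochhammer_rGamma_growth[OF assms, of a 1] that by metis
qed

text \<open>The hypothesis makes the double family absolutely summable when grouped by diagonals n +
  k = N; unconditional summability then permits regrouping by rows.\<close>

lemma diagonal_summation:
  fixes f :: "nat \<Rightarrow> nat \<Rightarrow> 'a::banach"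
  assumes g: "summable g" and le: "\<And>N. (\<Sum>n\<le>N. norm (f n (N - n))) \<le> g N"
  shows "summable (f n)"
    and "(\<lambda>n. \<Sum>k. f n k) sums (\<Sum>N. \<Sum>n\<le>N. f n (N - n))"
proof -
  let ?D = "Sigma UNIV (\<lambda>N::nat. {..N})"
  define h where "h = (\<lambda>(N, n). f n (N - n))"
  have "summable (\<lambda>N. \<Sum>n\<le>N. norm (f n (N - n)))"
    by (rule summable_comparison_test'[OF g, of 0]) (use le in \<open>simp add: sum_nonneg\<close>)
  then have "(\<lambda>N. norm (\<Sum>\<^sub>\<infinity>n\<in>{..N}. norm (h (N, n)))) summable_on UNIV"
    by (simp add: h_def sum_nonneg norm_summable_imp_summable_on)
  then have "(\<lambda>p. norm (h p)) summable_on ?D"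
    by (subst Infinite_Sum.abs_summable_on_Sigma_iff) auto
  then have "h summable_on ?D"
    by (rule Infinite_Sum.abs_summable_summable)
  then obtain S where S: "(h has_sum S) ?D"
    by (auto simp: summable_on_def)
  \<comment> \<open>The pairs (N, n) with n \<le> N correspond bijectively to the pairs (n, k) via k
    = N - n.\<close>
  have "(h has_sum S) ?D \<longleftrightarrow> ((\<lambda>(n, k). f n k) has_sum S) (UNIV \<times> UNIV)"
    by (rule has_sum_reindex_bij_witness[where i = "\<lambda>(n, k). (n + k, n)" and j = "\<lambda>(N, n). (n, N - n)"])
      (auto simp: h_def)
  with S have S': "((\<lambda>(n, k). f n k) has_sum S) (UNIV \<times> UNIV)" by simp
  have inner: "f n summable_on UNIV" for n
  proof -
    have "(\<lambda>(n, k). f n k) summable_on (Pair n ` UNIV)"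
      by (rule summable_on_subset_banach[OF has_sum_imp_summable[OF S']]) auto
    then have "((\<lambda>(n, k). f n k) \<circ> Pair n) summable_on UNIV"
      by (subst summable_on_reindex[symmetric]) (auto simp: inj_on_def)
    then show ?thesis by (simp add: o_def)
  qed
  then have hs: "(f n has_sum (\<Sum>\<^sub>\<infinity>k. f n k)) UNIV" for n
    by simp
  then have "f n sums (\<Sum>\<^sub>\<infinity>k. f n k)" for n
    by (rule has_sum_imp_sums)
  then have "summable (f n)" and infsum_eq: "(\<Sum>\<^sub>\<infinity>k. f n k) = (\<Sum>k. f n k)" for n
    by (auto simp: sums_iff)
  then show "summable (f n)" by blast
  have "((\<lambda>n. \<Sum>\<^sub>\<infinity>k. f n k) has_sum S) UNIV"
    by (rule has_sum_SigmaD[OF S']) (use hs in auto)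
  then have "(\<lambda>n. \<Sum>k. f n k) sums S"
    unfolding infsum_eq by (rule has_sum_imp_sums)
  moreover have "((\<lambda>N. \<Sum>n\<le>N. f n (N - n)) has_sum S) UNIV"
    by (rule has_sum_SigmaD[OF S]) (auto simp: h_def has_sum_finite)
  then have "(\<lambda>N. \<Sum>n\<le>N. f n (N - n)) sums S"
    by (rule has_sum_imp_sums)
  ultimately show "(\<lambda>n. \<Sum>k. f n k) sums (\<Sum>N. \<Sum>n\<le>N. f n (N - n))"
    by (simp add: sums_iff)
qed

lemma powr_of_real_exp:
  assumes "0 < x"
  shows "complex_of_real x powr a = exp (a * of_real (ln x))"
  using assms by (simp add: powr_def Ln_of_real)

text \<open>Continuity of r^m q at r = 1. It supplies the growth base: m factors of size r^n
  multiplied by q^n are still dominated by a convergent geometric series.\<close>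

lemma exists_base_near_one:
  fixes q :: real
  assumes "q < 1"
  obtains r where "1 < r" "r ^ m * q < 1"
proof -
  have "((\<lambda>r. r ^ m * q) \<longlongrightarrow> 1 ^ m * q) (at_right 1)"
    by (intro tendsto_intros)
  then have "eventually (\<lambda>r. r ^ m * q < 1) (at_right 1)"
    using assms by (intro order_tendstoD) auto
  moreover have "eventually (\<lambda>r::real. 1 < r) (at_right 1)"
    by (rule eventually_at_right_less)
  ultimately have "eventually (\<lambda>r. 1 < r \<and> r ^ m * q < 1) (at_right 1)"
    by eventually_elim simp
  then show ?thesis
    using eventually_happens'[of "at_right (1::real)"] that by auto
qed

section \<open>The regularised hypergeometric series\<close>

lemma summable_hypergeo_reg:
  fixes a b c z :: complex
  assumes "norm z < 1"
  shows "summable (\<lambda>k. pochhammer a k * pochhammer b k * rGamma (c + of_nat k) / fact k * z ^ k)"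
proof -
  \<comment> \<open>The exponent 2 pays for two growth factors, (a)_k / k! and (b)_k
    \<open>rGamma\<close>(c + k).\<close>
  obtain r where r: "1 < r" "r ^ 2 * norm z < 1"
    using exists_base_near_one[of "norm z" 2] assms by auto
  obtain A where A: "0 \<le> A" "\<And>n. norm (pochhammer a n / fact n) \<le> A * r ^ n"
    using pochhammer_fact_growth[OF r(1), of a] by metis
  obtain B where B: "0 \<le> B" "\<And>n. norm (pochhammer b n * rGamma (c + of_nat n)) \<le> B * r ^ n"
    using pochhammer_rGamma_growth[OF r(1), of b c] by metis
  have "summable (\<lambda>k. A * B * (r ^ 2 * norm z) ^ k)"
    using r by (intro summable_mult summable_geometric) (simp add: abs_mult)
  then show ?thesis
  proof (rule summable_comparison_test'[of _ 0])
    fix k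
    have "norm (pochhammer a k * pochhammer b k * rGamma (c + of_nat k) / fact k * z ^ k) =
        norm (pochhammer a k / fact k) * norm (pochhammer b k * rGamma (c + of_nat k)) * norm z ^ k"
      by (simp add: norm_mult norm_divide norm_power)
    also have "\<dots> \<le> (A * r ^ k) * (B * r ^ k) * norm z ^ k"
      using A B r(1) by (intro mult_mono mult_nonneg_nonneg) auto
    finally show "norm (pochhammer a k * pochhammer b k * rGamma (c + of_nat k) / fact k * z ^ k)
        \<le> A * B * (r ^ 2 * norm z) ^ k"
      by (simp add: power_mult_distrib power2_eq_square mult_ac)
  qed
qed

text \<open>Weierstrass M-test. On the compact set the three parameters are bounded by one
  \<open>R\<close>, so the ratios of consecutive terms are bounded uniformly by a sequence tending
  to |z|, and the tail is dominated by a geometric series.\<close>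

lemma continuous_on_hypergeo_reg:
  fixes a b c :: "'a::topological_space \<Rightarrow> complex" and z :: complex
  assumes K: "compact K" and cont: "continuous_on K a" "continuous_on K b" "continuous_on K c"
    and z: "norm z < 1"
  shows "continuous_on K (\<lambda>m. hypergeo_reg (a m) (b m) (c m) z)"
proof -
  define u where "u = (\<lambda>k m. pochhammer (a m) k * pochhammer (b m) k * rGamma (c m + of_nat k) / fact k * z ^ k)"
  have "bounded (a ` K \<union> b ` K \<union> c ` K)"
    using K cont by (intro bounded_Un[THEN iffD2] conjI compact_imp_bounded compact_continuous_image)
  then obtain R where R: "\<And>w. w \<in> a ` K \<union> b ` K \<union> c ` K \<Longrightarrow> norm w \<le> R"
    by (meson bounded_iff)
  obtain \<rho> where \<rho>: "norm z < \<rho>" "\<rho> < 1"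
    using z dense by blast
  have "0 \<le> norm z" by simp
  with \<rho> have "0 < \<rho>" by linarith
  \<comment> \<open>\<open>s k\<close> bounds the ratio of terms k + 1 and k as soon as k >
    \<open>R\<close>; then c + k also stays away from 0, with |c + k| at least k -
    \<open>R\<close>.\<close>
  define s where "s = (\<lambda>k. (R + of_nat k) / (1 + of_nat k) * ((R + of_nat k) / (- R + of_nat k)) * norm z)"
  have "s \<longlonglongrightarrow> 1 * 1 * norm z"
    unfolding s_def by (intro tendsto_mult tendsto_shift_ratio tendsto_const)
  then have "eventually (\<lambda>k. s k < \<rho>) sequentially"
    using \<rho> by (intro order_tendstoD) auto
  moreover have "eventually (\<lambda>k. R < real k) sequentially"
    using filterlim_real_sequentially by (simp add: filterlim_at_top_dense)
  ultimately have "eventually (\<lambda>k. s k < \<rho> \<and> R < real k) sequentially"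
    by eventually_elim simp
  then obtain N where N: "\<And>k. N \<le> k \<Longrightarrow> s k < \<rho> \<and> R < real k"
    by (auto simp: eventually_sequentially)
  have cont_u: "continuous_on K (u k)" for k
  proof -
    have "continuous_on K (\<lambda>m. rGamma (c m + of_nat k))"
      by (rule continuous_on_compose2[OF continuous_on_rGamma[of UNIV]]) (auto intro!: continuous_intros cont)
    then show ?thesis
      unfolding u_def pochhammer_prod by (intro continuous_intros cont) auto
  qed
  have step: "norm (u (Suc k) m) \<le> \<rho> * norm (u k m)" if "N \<le> k" "m \<in> K" for k m
  proof -
    have *: "norm (a m) \<le> R" "norm (b m) \<le> R" "norm (c m) \<le> R" "R < real k"
      using R N that by auto
    have n1: "norm (a m + of_nat k) \<le> R + real k" "norm (b m + of_nat k) \<le> R + real k"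
      using * norm_triangle_ineq[of "a m" "of_nat k"] norm_triangle_ineq[of "b m" "of_nat k"] by auto
    have n2: "- R + real k \<le> norm (c m + of_nat k)"
      using * norm_diff_ineq[of "of_nat k" "c m"] by (simp add: add.commute)
    have "c m + of_nat k \<noteq> 0" using n2 * by auto
    moreover have "(c m + of_nat k) * rGamma (c m + of_nat (Suc k)) = rGamma (c m + of_nat k)"
      using rGamma_plus1[of "c m + of_nat k"] by (simp add: add_ac)
    ultimately have rG: "rGamma (c m + of_nat (Suc k)) = rGamma (c m + of_nat k) / (c m + of_nat k)"
      by (simp add: nonzero_eq_divide_eq mult.commute)
    have "fact (Suc k) = (1 + of_nat k) * (fact k :: complex)" by simp
    then have "u (Suc k) m = (a m + of_nat k) / (1 + of_nat k) * ((b m + of_nat k) / (c m + of_nat k)) * z * u k m"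
      by (simp only: u_def pochhammer_Suc power_Suc rG mult_ac times_divide_eq_right times_divide_eq_left
          divide_divide_eq_left divide_divide_eq_right)
    then have "norm (u (Suc k) m) = norm (a m + of_nat k) / (1 + real k) *
        (norm (b m + of_nat k) / norm (c m + of_nat k)) * norm z * norm (u k m)"
      using norm_of_nat[of "Suc k", where ?'a = complex] by (simp add: norm_mult norm_divide)
    also have "\<dots> \<le> (R + real k) / (1 + real k) * ((R + real k) / (- R + real k)) * norm z * norm (u k m)"
      using n1 n2 *(4) order_trans[OF norm_ge_zero n1(1)]
      by (intro mult_right_mono mult_mono frac_le divide_nonneg_nonneg mult_nonneg_nonneg) auto
    also have "\<dots> \<le> \<rho> * norm (u k m)"
      using N[OF that(1)] by (intro mult_right_mono) (auto simp: s_def)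
    finally show ?thesis .
  qed
  have "bounded (u N ` K)"
    by (intro compact_imp_bounded compact_continuous_image cont_u K)
  then obtain C where C: "\<And>m. m \<in> K \<Longrightarrow> norm (u N m) \<le> C"
    by (auto simp: bounded_iff)
  have tail: "norm (u (N + j) m) \<le> C * \<rho> ^ j" if "m \<in> K" for j m
  proof (induction j)
    case 0
    show ?case using C that by simp
  next
    case (Suc j)
    have "norm (u (Suc (N + j)) m) \<le> \<rho> * norm (u (N + j) m)"
      using that by (intro step) auto
    also have "\<dots> \<le> \<rho> * (C * \<rho> ^ j)"
      using Suc \<open>0 < \<rho>\<close> by (intro mult_left_mono) auto
    finally show ?case by (simp add: mult_ac)
  qed
  have "eventually (\<lambda>k. \<forall>m\<in>K. norm (u k m) \<le> C * \<rho> ^ (k - N)) sequentially"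
    using eventually_ge_at_top[of N]
  proof eventually_elim
    case (elim k)
    then show ?case using tail[of _ "k - N"] by auto
  qed
  moreover have "summable (\<lambda>k. C * \<rho> ^ (k - N))"
  proof (rule summable_mult)
    have "summable (\<lambda>k. \<rho> ^ (k + N - N))"
      using \<rho> \<open>0 < \<rho>\<close> by (simp add: summable_geometric)
    then show "summable (\<lambda>k. \<rho> ^ (k - N))"
      by (subst (asm) summable_iff_shift)
  qed
  ultimately have "uniform_limit K (\<lambda>n m. \<Sum>k<n. u k m) (\<lambda>m. \<Sum>k. u k m) sequentially"
    by (rule Weierstrass_m_test_ev)
  then have "continuous_on K (\<lambda>m. \<Sum>k. u k m)"
    by (rule uniform_limit_theorem[rotated]) (auto intro!: always_eventually continuous_intros cont_u)
  then show ?thesis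
    by (simp add: hypergeo_reg_def u_def)
qed

section \<open>Binomial series and Pfaff's transformation\<close>

lemma binomial_series_pochhammer:
  fixes z a :: complex
  assumes "norm z < 1"
  shows "(\<lambda>n. pochhammer a n / fact n * z ^ n) sums (1 - z) powr (- a)"
proof -
  have "((- a) gchoose n) * (- z) ^ n = pochhammer a n / fact n * z ^ n" for n
  proof -
    have "((- a) gchoose n) * (- z) ^ n = ((-1) ^ n * (-1) ^ n) * (pochhammer a n / fact n * z ^ n)"
      by (simp add: gbinomial_pochhammer power_minus[of z] mult_ac)
    also have "(-1) ^ n * (-1) ^ n = (1 :: complex)"
      by (simp add: minus_one_power_iff)
    finally show ?thesis by simp
  qed
  then show ?thesis
    using gen_binomial_complex[of "- z" "- a"] assms by simp
qed

text \<open>Each power (1 - z)^(-a-k) on the right is expanded by the binomial series; summing the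
  resulting double series along diagonals gives the left side by Chu-Vandermonde. For z < 1/2 the
  new argument has modulus z/(1 - z) < 1 and the majorant (2z)^N converges.\<close>

lemma hypergeo_reg_pfaff:
  fixes a b c :: complex and z :: real
  assumes z: "0 \<le> z" "z < 1 / 2"
  shows "hypergeo_reg a b c (of_real z) =
    of_real (1 - z) powr (- a) * hypergeo_reg a (c - b) c (- of_real (z / (1 - z)))"
proof -
  let ?z = "complex_of_real z"
  define f where "f = (\<lambda>k j. pochhammer a (k + j) * pochhammer (c - b) k * rGamma (c + of_nat k) *
    (-1) ^ k * ?z ^ (k + j) / (fact k * fact j))"
  define g where "g = (\<lambda>k. pochhammer a k * pochhammer (c - b) k * rGamma (c + of_nat k) / fact k *
    (- of_real (z / (1 - z))) ^ k)"
  obtain r where r: "1 < r" "r ^ 2 * (2 * z) < 1"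
    using z exists_base_near_one[of "2 * z" 2] by auto
  obtain C where C: "0 \<le> C" "\<And>n. norm (pochhammer a n / fact n) \<le> C * r ^ n"
    using pochhammer_fact_growth[OF r(1)] by metis
  obtain D where D: "0 \<le> D" "\<And>n. norm (pochhammer (c - b) n * rGamma (c + of_nat n)) \<le> D * r ^ n"
    using pochhammer_rGamma_growth[OF r(1)] by metis
  have bound: "norm (f k (N - k)) \<le> real (N choose k) * (C * D * (r ^ 2 * z) ^ N)" if "k \<le> N" for k N
  proof -
    have "f k (N - k) = of_nat (N choose k) * (pochhammer a N / fact N) *
        (pochhammer (c - b) k * rGamma (c + of_nat k)) * (-1) ^ k * ?z ^ N"
      using that by (simp add: f_def binomial_fact field_simps)
    then have "norm (f k (N - k)) = real (N choose k) * norm (pochhammer a N / fact N) *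
        norm (pochhammer (c - b) k * rGamma (c + of_nat k)) * z ^ N"
      using z(1) by (simp add: norm_mult norm_power norm_divide)
    also have "\<dots> \<le> real (N choose k) * (C * r ^ N) * (D * r ^ k) * z ^ N"
      using z(1) C D r(1) by (intro mult_mono mult_nonneg_nonneg) auto
    also have "\<dots> \<le> real (N choose k) * (C * r ^ N) * (D * r ^ N) * z ^ N"
      using z(1) C(1) D(1) r(1) that
      by (intro mult_right_mono mult_left_mono power_increasing mult_nonneg_nonneg) auto
    finally show ?thesis
      by (simp add: power_mult_distrib power2_eq_square mult_ac)
  qed
  \<comment> \<open>The binomial coefficients on a diagonal add up to 2^N, whence the argument
    2z.\<close>
  have le: "(\<Sum>k\<le>N. norm (f k (N - k))) \<le> C * D * (r ^ 2 * (2 * z)) ^ N" for N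
  proof -
    have "(\<Sum>k\<le>N. norm (f k (N - k))) \<le> (\<Sum>k\<le>N. real (N choose k) * (C * D * (r ^ 2 * z) ^ N))"
      using bound by (intro sum_mono) auto
    also have "\<dots> = real (\<Sum>k\<le>N. N choose k) * (C * D * (r ^ 2 * z) ^ N)"
      by (simp add: sum_distrib_right)
    also have "\<dots> = C * D * (r ^ 2 * (2 * z)) ^ N"
      by (simp add: choose_row_sum power_mult_distrib mult_ac)
    finally show ?thesis .
  qed
  have "summable (\<lambda>N. C * D * (r ^ 2 * (2 * z)) ^ N)"
    using r z by (intro summable_mult summable_geometric) auto
  then have sums: "(\<lambda>k. \<Sum>j. f k j) sums (\<Sum>N. \<Sum>k\<le>N. f k (N - k))"
    by (rule diagonal_summation(2)) (rule le)
  \<comment> \<open>Here (a)_(k+j) = (a)_k (a+k)_j, and the factor (1 - z)^(-k) of the binomial sum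
    turns (-z)^k into the k-th power of -z/(1 - z).\<close>
  have row: "(\<Sum>j. f k j) = of_real (1 - z) powr (- a) * g k" for k
  proof -
    have "(\<lambda>j. pochhammer (a + of_nat k) j / fact j * ?z ^ j) sums (1 - ?z) powr (- (a + of_nat k))"
      using z by (intro binomial_series_pochhammer) auto
    then have "(\<lambda>j. pochhammer a k * pochhammer (c - b) k * rGamma (c + of_nat k) * (- ?z) ^ k / fact k *
        (pochhammer (a + of_nat k) j / fact j * ?z ^ j)) sums
        (pochhammer a k * pochhammer (c - b) k * rGamma (c + of_nat k) * (- ?z) ^ k / fact k *
         (1 - ?z) powr (- (a + of_nat k)))"
      by (rule sums_mult)
    moreover have "(\<lambda>j. pochhammer a k * pochhammer (c - b) k * rGamma (c + of_nat k) * (- ?z) ^ k / fact k *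
        (pochhammer (a + of_nat k) j / fact j * ?z ^ j)) = f k"
      by (simp add: fun_eq_iff f_def pochhammer_product' power_add power_minus[of ?z] mult_ac)
    moreover have "complex_of_real (1 - z) \<noteq> 0"
      using z by (subst of_real_eq_0_iff) simp
    then have "1 - ?z \<noteq> 0" by simp
    then have "(1 - ?z) powr (- (a + of_nat k)) = (1 - ?z) powr (- a) / (1 - ?z) ^ k"
      by (simp add: powr_diff powr_nat')
    ultimately have "(\<Sum>j. f k j) = pochhammer a k * pochhammer (c - b) k * rGamma (c + of_nat k) *
        (- ?z) ^ k / fact k * ((1 - ?z) powr (- a) / (1 - ?z) ^ k)"
      by (simp add: sums_iff)
    moreover have "(- of_real (z / (1 - z))) ^ k = (- ?z) ^ k / (1 - ?z) ^ k"
      by (simp flip: power_divide)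
    ultimately show ?thesis
      by (simp add: g_def mult_ac)
  qed
  \<comment> \<open>Raising the argument of \<open>rGamma\<close> from c + k to c + N produces (c +
    k)_(N-k); Chu-Vandermonde with d = c - b then leaves (b)_N.\<close>
  have diag: "(\<Sum>k\<le>N. f k (N - k)) =
      pochhammer a N * pochhammer b N * rGamma (c + of_nat N) / fact N * ?z ^ N" for N
  proof -
    have "(\<Sum>k\<le>N. f k (N - k)) = (\<Sum>k\<le>N. pochhammer a N * rGamma (c + of_nat N) / fact N * ?z ^ N *
       (of_nat (N choose k) * (-1) ^ k * pochhammer (c - b) k * pochhammer (c + of_nat k) (N - k)))"
    proof (intro sum.cong refl)
      fix k assume "k \<in> {..N}"
      then have "rGamma (c + of_nat k) = pochhammer (c + of_nat k) (N - k) * rGamma (c + of_nat N)"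
        using pochhammer_rGamma[of "c + of_nat k" "N - k"] by (simp add: of_nat_diff)
      then show "f k (N - k) = pochhammer a N * rGamma (c + of_nat N) / fact N * ?z ^ N *
       (of_nat (N choose k) * (-1) ^ k * pochhammer (c - b) k * pochhammer (c + of_nat k) (N - k))"
        using \<open>k \<in> {..N}\<close> by (simp add: f_def binomial_fact field_simps)
    qed
    also have "\<dots> = pochhammer a N * rGamma (c + of_nat N) / fact N * ?z ^ N * pochhammer b N"
      unfolding sum_distrib_left[symmetric] vandermonde_alternating by simp
    finally show ?thesis by simp
  qed
  have "hypergeo_reg a b c ?z = (\<Sum>k. of_real (1 - z) powr (- a) * g k)"
    using sums unfolding row diag hypergeo_reg_def by (simp add: sums_iff)
  also have "\<dots> = of_real (1 - z) powr (- a) * (\<Sum>k. g k)"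
  proof (rule suminf_mult)
    have "complex_of_real (1 - z) powr (- a) \<noteq> 0" using z by auto
    then show "summable g"
      using sums unfolding row by (metis sums_iff summable_cmult_iff)
  qed
  finally show ?thesis
    by (simp add: g_def hypergeo_reg_def)
qed

section \<open>Ferrers functions\<close>

text \<open>This is the coefficient of a diagonal in the double series for the right-hand side, with
  a = 2\<mu>. Reversing Pochhammer symbols brings it to Dixon's form.\<close>

lemma well_poised_coefficient_sum:
  fixes a l :: complex
  shows "(\<Sum>n\<le>N. pochhammer a n * pochhammer (- l) (N - n) * pochhammer (a - l) (N + n) *
      rGamma (1 + a + of_nat (N + n)) / (fact n * fact (N - n))) =
    pochhammer (a - l) N * pochhammer (a / 2 - l) N / fact N *
      (4 ^ N * pochhammer ((a + 1) / 2) N * rGamma (1 + a + 2 * of_nat N))"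
proof -
  \<comment> \<open>Chosen so that (a - l)_(N+n) = (a - l)_N (c)_n; then (-l)_(N-n) is, up to sign,
    the matching well-poised factor (1 + a - c + n)_(N-n).\<close>
  define c where "c = a - l + of_nat N"
  have "pochhammer a n * pochhammer (- l) (N - n) * pochhammer (a - l) (N + n) *
      rGamma (1 + a + of_nat (N + n)) / (fact n * fact (N - n)) =
      (-1) ^ N * pochhammer (a - l) N / fact N * rGamma (1 + a + 2 * of_nat N) *
      (of_nat (N choose n) * (-1) ^ n * pochhammer a n * pochhammer c n *
       pochhammer (1 + a - c + of_nat n) (N - n) *
       pochhammer (1 + a + of_nat N + of_nat n) (N - n))" if "n \<le> N" for n
  proof -
    have "pochhammer (- l) (N - n) = (-1) ^ (N - n) * pochhammer (1 + a - c + of_nat n) (N - n)"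
    proof -
      have "l - of_nat (N - n) + 1 = 1 + a - c + of_nat n"
        using that by (simp add: c_def of_nat_diff)
      then show ?thesis by (simp only: pochhammer_minus)
    qed
    also have "(-1) ^ (N - n) = ((-1) ^ N * (-1) ^ n :: complex)"
      using that by (simp add: minus_one_power_iff)
    finally have 1: "pochhammer (- l) (N - n) =
        (-1) ^ N * (-1) ^ n * pochhammer (1 + a - c + of_nat n) (N - n)" .
    have 2: "pochhammer (a - l) (N + n) = pochhammer (a - l) N * pochhammer c n"
      by (simp add: pochhammer_product' c_def)
    have 3: "rGamma (1 + a + of_nat (N + n)) =
        pochhammer (1 + a + of_nat N + of_nat n) (N - n) * rGamma (1 + a + 2 * of_nat N)"
      using pochhammer_rGamma[of "1 + a + of_nat (N + n)" "N - n"] that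
      by (simp add: of_nat_diff add_ac)
    have 4: "of_nat (N choose n) / fact N = (1 / (fact n * fact (N - n)) :: complex)"
      using that by (simp add: binomial_fact)
    have "pochhammer a n * pochhammer (- l) (N - n) * pochhammer (a - l) (N + n) *
        rGamma (1 + a + of_nat (N + n)) / (fact n * fact (N - n)) =
        (1 / (fact n * fact (N - n))) * (pochhammer a n * pochhammer (- l) (N - n) *
        pochhammer (a - l) (N + n) * rGamma (1 + a + of_nat (N + n)))"
      by simp
    also have "\<dots> = (-1) ^ N * pochhammer (a - l) N / fact N * rGamma (1 + a + 2 * of_nat N) *
      (of_nat (N choose n) * (-1) ^ n * pochhammer a n * pochhammer c n *
       pochhammer (1 + a - c + of_nat n) (N - n) *
       pochhammer (1 + a + of_nat N + of_nat n) (N - n))"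
      unfolding 1 2 3 4[symmetric] by (simp add: mult_ac)
    finally show ?thesis .
  qed
  then have "(\<Sum>n\<le>N. pochhammer a n * pochhammer (- l) (N - n) * pochhammer (a - l) (N + n) *
      rGamma (1 + a + of_nat (N + n)) / (fact n * fact (N - n))) =
      (-1) ^ N * pochhammer (a - l) N / fact N * rGamma (1 + a + 2 * of_nat N) *
      (4 ^ N * pochhammer (1 + a / 2 - c) N * pochhammer ((a + 1) / 2) N)"
    unfolding dixon_terminating[of N a c, symmetric] sum_distrib_left by (intro sum.cong) auto
  also have "pochhammer (1 + a / 2 - c) N = (-1) ^ N * pochhammer (a / 2 - l) N"
    using pochhammer_minus'[of "l - a / 2" N] by (simp add: c_def algebra_simps)
  also have "(-1) ^ N * pochhammer (a - l) N / fact N * rGamma (1 + a + 2 * of_nat N) *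
      (4 ^ N * ((-1) ^ N * pochhammer (a / 2 - l) N) * pochhammer ((a + 1) / 2) N) =
      ((-1) ^ N * (-1) ^ N) * (pochhammer (a - l) N * pochhammer (a / 2 - l) N / fact N *
      (4 ^ N * pochhammer ((a + 1) / 2) N * rGamma (1 + a + 2 * of_nat N)))"
    by (simp only: mult_ac times_divide_eq_right times_divide_eq_left)
  also have "(-1) ^ N * (-1) ^ N = (1 :: complex)"
    by (simp add: minus_one_power_iff)
  finally show ?thesis by simp
qed

text \<open>Pfaff's transformation writes the n-th summand as a common factor times row n of a
  double series in t; its diagonals are evaluated by
  \<open>well_poised_coefficient_sum\<close>.\<close>

lemma ferrers_P_series_sums:
  fixes l \<mu> :: complex and x :: real
  assumes x: "0 < x" "x < 1"
  defines "t \<equiv> (1 - x) / (1 + x)"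
  shows "(\<lambda>n. (-1) ^ n * pochhammer (2 * \<mu> - l) (2 * n) * pochhammer (2 * \<mu>) n / fact n *
           ferrers_P l (- 2 * \<mu> - 2 * of_nat n) x) sums
     (of_real t powr \<mu> * of_real ((1 + x) / 2) powr l *
      (\<Sum>N. pochhammer (2 * \<mu> - l) N * pochhammer (\<mu> - l) N / fact N *
      (4 ^ N * pochhammer (\<mu> + 1 / 2) N * rGamma (1 + 2 * \<mu> + 2 * of_nat N)) * (- of_real t) ^ N))"
proof -
  have t: "0 < t" "t < 1" using x by (auto simp: t_def)
  let ?t = "complex_of_real t"
  \<comment> \<open>The symbols (2\<mu> - l)_(2n) of the summand and (2\<mu> - l + 2n)_k from
    Pfaff's transformation are merged into (2\<mu> - l)_(2n+k).\<close>
  define f where "f = (\<lambda>n k. (-1) ^ n * pochhammer (2 * \<mu>) n / fact n *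
    pochhammer (2 * \<mu> - l) (2 * n + k) * pochhammer (- l) k / fact k *
    rGamma (1 + 2 * \<mu> + of_nat (2 * n + k)) * ?t ^ n * (- ?t) ^ k)"
  \<comment> \<open>The three growth factors contribute r^n, r^k and r^(2n+k), together at most
    r^(3(n+k)).\<close>
  obtain r where r: "1 < r" "r ^ 3 * t < 1"
    using t exists_base_near_one[of t 3] by auto
  obtain A where A: "0 \<le> A" "\<And>n. norm (pochhammer (2 * \<mu>) n / fact n) \<le> A * r ^ n"
    using pochhammer_fact_growth[OF r(1), of "2 * \<mu>"] by metis
  obtain B where B: "0 \<le> B" "\<And>n. norm (pochhammer (- l) n / fact n) \<le> B * r ^ n"
    using pochhammer_fact_growth[OF r(1), of "- l"] by metis
  obtain D where D: "0 \<le> D"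
    "\<And>n. norm (pochhammer (2 * \<mu> - l) n * rGamma (1 + 2 * \<mu> + of_nat n)) \<le> D * r ^ n"
    using pochhammer_rGamma_growth[OF r(1), of "2 * \<mu> - l" "1 + 2 * \<mu>"] by metis
  have bound: "norm (f n k) \<le> A * B * D * (r ^ 3 * t) ^ (n + k)" for n k
  proof -
    have "norm (f n k) = norm (pochhammer (2 * \<mu>) n / fact n) * norm (pochhammer (- l) k / fact k) *
        norm (pochhammer (2 * \<mu> - l) (2 * n + k) * rGamma (1 + 2 * \<mu> + of_nat (2 * n + k))) *
        t ^ (n + k)"
      using t(1) by (simp add: f_def norm_mult norm_divide norm_power power_add)
    also have "\<dots> \<le> (A * r ^ n) * (B * r ^ k) * (D * r ^ (2 * n + k)) * t ^ (n + k)"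
      using t(1) r(1) A B D by (intro mult_mono mult_nonneg_nonneg A(2) B(2) D(2)) simp_all
    also have "\<dots> = A * B * D * r ^ (3 * n + 2 * k) * t ^ (n + k)"
      by (simp add: mult_ac flip: power_add) (simp add: power_add power_mult_distrib eval_nat_numeral mult_ac)
    also have "\<dots> \<le> A * B * D * r ^ (3 * (n + k)) * t ^ (n + k)"
      using t(1) r(1) A(1) B(1) D(1)
      by (intro mult_right_mono mult_left_mono power_increasing mult_nonneg_nonneg) auto
    finally show ?thesis
      by (simp add: power_mult_distrib mult_ac flip: power_mult)
  qed
  have le: "(\<Sum>n\<le>N. norm (f n (N - n))) \<le> A * B * D * (real (Suc N) * (r ^ 3 * t) ^ N)" for N
  proof -
    have "(\<Sum>n\<le>N. norm (f n (N - n))) \<le> (\<Sum>n\<le>N. A * B * D * (r ^ 3 * t) ^ N)"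
    proof (rule sum_mono)
      fix n assume "n \<in> {..N}"
      then show "norm (f n (N - n)) \<le> A * B * D * (r ^ 3 * t) ^ N"
        using bound[of n "N - n"] by simp
    qed
    then show ?thesis by (simp add: mult_ac)
  qed
  \<comment> \<open>The N + 1 entries of a diagonal share one bound, so the majorant is a
    differentiated geometric series.\<close>
  have g: "summable (\<lambda>N. A * B * D * (real (Suc N) * (r ^ 3 * t) ^ N))"
    using geometric_deriv_sums[of "r ^ 3 * t"] r t
    by (intro summable_mult) (simp add: sums_iff abs_mult)
  note smb = diagonal_summation(1)[of _ f, OF g le] and sums = diagonal_summation(2)[of _ f, OF g le]
  have row: "(-1) ^ n * pochhammer (2 * \<mu> - l) (2 * n) * pochhammer (2 * \<mu>) n / fact n *
      ferrers_P l (- 2 * \<mu> - 2 * of_nat n) x =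
      ?t powr \<mu> * of_real ((1 + x) / 2) powr l * (\<Sum>k. f n k)" for n
  proof -
    have half: "- (- 2 * \<mu> - 2 * of_nat n) / 2 = \<mu> + of_nat n" by (simp add: field_simps)
    have pw: "?t powr (- (- 2 * \<mu> - 2 * of_nat n) / 2) = ?t powr \<mu> * ?t ^ n"
      unfolding half using t(1) by (simp add: powr_add powr_nat')
    have z: "1 - (1 - x) / 2 = (1 + x) / 2" "(1 - x) / 2 / ((1 + x) / 2) = t"
      using x by (simp_all add: t_def field_simps)
    have "1 - (- 2 * \<mu> - 2 * of_nat n) = 1 + 2 * \<mu> + 2 * of_nat n" by simp
    then have "hypergeo_reg (- l) (l + 1) (1 - (- 2 * \<mu> - 2 * of_nat n)) (of_real ((1 - x) / 2)) =
        of_real ((1 + x) / 2) powr l *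
        hypergeo_reg (- l) (2 * \<mu> - l + of_nat (2 * n)) (1 + 2 * \<mu> + 2 * of_nat n) (- ?t)"
      using hypergeo_reg_pfaff[of "(1 - x) / 2" "- l" "l + 1" "1 + 2 * \<mu> + 2 * of_nat n"] x
      unfolding z by (simp add: algebra_simps)
    then have "(-1) ^ n * pochhammer (2 * \<mu> - l) (2 * n) * pochhammer (2 * \<mu>) n / fact n *
      ferrers_P l (- 2 * \<mu> - 2 * of_nat n) x = ?t powr \<mu> * of_real ((1 + x) / 2) powr l *
      ((-1) ^ n * pochhammer (2 * \<mu> - l) (2 * n) * pochhammer (2 * \<mu>) n / fact n * ?t ^ n *
      hypergeo_reg (- l) (2 * \<mu> - l + of_nat (2 * n)) (1 + 2 * \<mu> + 2 * of_nat n) (- ?t))"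
      unfolding ferrers_P_def t_def[symmetric] pw by (simp only: mult_ac times_divide_eq_right times_divide_eq_left)
    also have "(-1) ^ n * pochhammer (2 * \<mu> - l) (2 * n) * pochhammer (2 * \<mu>) n / fact n * ?t ^ n *
      hypergeo_reg (- l) (2 * \<mu> - l + of_nat (2 * n)) (1 + 2 * \<mu> + 2 * of_nat n) (- ?t) = (\<Sum>k. f n k)"
    proof -
      define p where "p = (-1) ^ n * pochhammer (2 * \<mu> - l) (2 * n) * pochhammer (2 * \<mu>) n / fact n * ?t ^ n"
      define h where "h = (\<lambda>k. pochhammer (- l) k * pochhammer (2 * \<mu> - l + of_nat (2 * n)) k *
        rGamma (1 + 2 * \<mu> + 2 * of_nat n + of_nat k) / fact k * (- ?t) ^ k)"
      have fn: "f n = (\<lambda>k. p * h k)"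
      proof
        fix k
        have "1 + 2 * \<mu> + of_nat (2 * n + k) = 1 + 2 * \<mu> + 2 * of_nat n + of_nat k" by simp
        then show "f n k = p * h k"
          unfolding f_def p_def h_def pochhammer_product'[of "2 * \<mu> - l" "2 * n" k]
          by (simp only: mult_ac times_divide_eq_right times_divide_eq_left divide_divide_eq_left)
      qed
      have "(\<Sum>k. p * h k) = p * (\<Sum>k. h k)"
      \<comment> \<open>Summability of \<open>h\<close> can be recovered from that of
        \<open>f n\<close> only when \<open>p\<close> is nonzero; otherwise both sides are
        0.\<close>
      proof (cases "p = 0")
        case False
        with smb[of n] have "summable h" by (simp add: fn summable_cmult_iff)
        then show ?thesis by (rule suminf_mult)
      qed simp
      then show ?thesis
        unfolding fn p_def[symmetric] hypergeo_reg_def h_def by simp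
    qed
    finally show ?thesis .
  qed
  have diag: "(\<Sum>n\<le>N. f n (N - n)) = pochhammer (2 * \<mu> - l) N * pochhammer (\<mu> - l) N / fact N *
      (4 ^ N * pochhammer (\<mu> + 1 / 2) N * rGamma (1 + 2 * \<mu> + 2 * of_nat N)) * (- ?t) ^ N" for N
  proof -
    have "f n (N - n) = (- ?t) ^ N * (pochhammer (2 * \<mu>) n * pochhammer (- l) (N - n) *
      pochhammer (2 * \<mu> - l) (N + n) * rGamma (1 + 2 * \<mu> + of_nat (N + n)) / (fact n * fact (N - n)))"
      if "n \<le> N" for n
    proof -
      have e: "2 * n + (N - n) = N + n" using that by simp
      have s: "(- ?t) ^ N = (-1) ^ n * ?t ^ n * (- ?t) ^ (N - n)"
        using that unfolding power_minus[of ?t n, symmetric] by (simp flip: power_add)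
      show ?thesis
        unfolding f_def e s by (simp only: mult_ac times_divide_eq_right times_divide_eq_left divide_divide_eq_left)
    qed
    then have "(\<Sum>n\<le>N. f n (N - n)) = (- ?t) ^ N * (\<Sum>n\<le>N. pochhammer (2 * \<mu>) n * pochhammer (- l) (N - n) *
      pochhammer (2 * \<mu> - l) (N + n) * rGamma (1 + 2 * \<mu> + of_nat (N + n)) / (fact n * fact (N - n)))"
      unfolding sum_distrib_left by (intro sum.cong) auto
    moreover have "(2 * \<mu> + 1) / 2 = \<mu> + 1 / 2" "2 * \<mu> / 2 = \<mu>"
      by (simp_all add: field_simps)
    ultimately show ?thesis
      unfolding well_poised_coefficient_sum by (simp only: mult_ac)
  qed
  show ?thesis
    unfolding row using sums_mult[OF sums[unfolded diag]] by blast
qed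

text \<open>Legendre's duplication formula at z = \<mu> + 1/2 + n, where 2z = 1 + 2\<mu> + 2n and z
  + 1/2 = 1 + \<mu> + n. The factor (\<mu> + 1/2)_n moves \<Gamma>(\<mu> + 1/2) to
  \<Gamma>(z).\<close>

lemma rGamma_duplication_shift:
  fixes \<mu> :: complex
  assumes "\<mu> + 1 / 2 \<notin> \<int>\<^sub>\<le>\<^sub>0"
  shows "2 powr (2 * \<mu>) * Gamma (\<mu> + 1 / 2) * (4 ^ n * pochhammer (\<mu> + 1 / 2) n *
    rGamma (1 + 2 * \<mu> + 2 * of_nat n)) = of_real (sqrt pi) * rGamma (1 + \<mu> + of_nat n)"
proof (cases "1 + \<mu> + of_nat n \<in> \<int>\<^sub>\<le>\<^sub>0")
  \<comment> \<open>Both reciprocal Gamma values vanish: if 1 + \<mu> + n = -j, then 1 + 2\<mu> + 2n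
    = -(2j + 1).\<close>
  case True
  then obtain j where j: "1 + \<mu> + of_nat n = - of_nat j" by (elim nonpos_Ints_cases')
  have "1 + 2 * \<mu> + 2 * of_nat n = 2 * (1 + \<mu> + of_nat n) - 1" by simp
  also have "\<dots> = - of_nat (2 * j + 1)" by (simp add: j)
  finally have "1 + 2 * \<mu> + 2 * of_nat n \<in> \<int>\<^sub>\<le>\<^sub>0"
    by (simp only: minus_of_nat_in_nonpos_Ints)
  then have "rGamma (1 + 2 * \<mu> + 2 * of_nat n) = 0" "rGamma (1 + \<mu> + of_nat n) = 0"
    using True by (simp_all only: rGamma_eq_zero_iff)
  then show ?thesis by simp
next
  case False
  define z where "z = \<mu> + 1 / 2 + of_nat n"
  have z: "z \<notin> \<int>\<^sub>\<le>\<^sub>0"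
    using assms nonpos_Ints_diff_Nats[of z "of_nat n"] by (auto simp: z_def)
  have z2: "z + 1 / 2 = 1 + \<mu> + of_nat n" "2 * z = 1 + 2 * \<mu> + 2 * of_nat n"
    by (simp_all add: z_def algebra_simps)
  have nz: "Gamma z \<noteq> 0" "Gamma (z + 1 / 2) \<noteq> 0"
    using z False by (simp_all add: z2 Gamma_eq_zero_iff)
  have dup: "Gamma z * Gamma (z + 1 / 2) = exp ((1 - 2 * z) * of_real (ln 2)) * of_real (sqrt pi) * Gamma (2 * z)"
    using z False by (intro Gamma_legendre_duplication) (simp_all add: z2)
  have "exp (of_nat n * of_real (ln 4)) = (4 :: complex) ^ n"
    using exp_of_real[of "ln 4", where ?'a = complex] by (simp add: exp_of_nat_mult)
  moreover have "ln (4::real) = 2 * ln 2"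
    using ln_realpow[of 2 2] by simp
  ultimately have four: "(4 :: complex) ^ n = exp (2 * of_nat n * of_real (ln 2))"
    by (simp add: mult_ac)
  have two: "2 powr (2 * \<mu>) = exp (2 * \<mu> * of_real (ln 2))"
    using powr_of_real_exp[of 2 "2 * \<mu>"] by simp
  have "2 * \<mu> * of_real (ln 2) + 2 * of_nat n * of_real (ln 2) + (1 - 2 * z) * of_real (ln 2) = 0"
    unfolding z2 by (simp add: algebra_simps)
  then have e: "2 powr (2 * \<mu>) * 4 ^ n * exp ((1 - 2 * z) * of_real (ln 2)) = 1"
    unfolding four two by (simp only: exp_add[symmetric] exp_zero)
  have G: "Gamma (\<mu> + 1 / 2) * pochhammer (\<mu> + 1 / 2) n = Gamma z"
    using assms by (simp add: z_def pochhammer_Gamma Gamma_eq_zero_iff)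
  have "2 powr (2 * \<mu>) * Gamma (\<mu> + 1 / 2) * (4 ^ n * pochhammer (\<mu> + 1 / 2) n * rGamma (2 * z)) *
      Gamma (z + 1 / 2) = 2 powr (2 * \<mu>) * 4 ^ n * (Gamma (\<mu> + 1 / 2) * pochhammer (\<mu> + 1 / 2) n *
      Gamma (z + 1 / 2)) * rGamma (2 * z)"
    by (simp add: mult_ac)
  also have "\<dots> = (2 powr (2 * \<mu>) * 4 ^ n * exp ((1 - 2 * z) * of_real (ln 2))) * of_real (sqrt pi) *
      (Gamma (2 * z) * rGamma (2 * z))"
    unfolding G dup by (simp add: mult_ac)
  also have "\<dots> = of_real (sqrt pi) * (Gamma (2 * z) * rGamma (2 * z))"
    unfolding e by simp
  also have "Gamma (2 * z) * rGamma (2 * z) = 1"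
  proof -
    \<comment> \<open>\<open>Gamma\<close> has the value 0 at its poles, so the nonzero product in
      \<open>dup\<close> also excludes a pole at 2z.\<close>
    have "Gamma (2 * z) \<noteq> 0"
      using dup nz by (metis mult_eq_0_iff)
    then show ?thesis by (simp add: rGamma_inverse_Gamma)
  qed
  finally have "2 powr (2 * \<mu>) * Gamma (\<mu> + 1 / 2) * (4 ^ n * pochhammer (\<mu> + 1 / 2) n * rGamma (2 * z)) =
      of_real (sqrt pi) / Gamma (z + 1 / 2)"
    by (simp only: nonzero_eq_divide_eq[OF nz(2)] mult_1_right)
  then show ?thesis
    by (simp only: z2 rGamma_inverse_Gamma divide_inverse[of _ "Gamma _"])
qed

section \<open>Continuity, excluded parameter values and the final assembly\<close>

text \<open>Degree and order vary together here. A closed disc around \<mu> supplies the compact set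
  for the uniform convergence argument.\<close>

lemma isCont_ferrers_P:
  assumes "0 < x" "x < 1"
  shows "isCont (\<lambda>m. ferrers_P (l - m) (- m) x) \<mu>"
proof -
  have "continuous_on (cball \<mu> 1) (\<lambda>m. hypergeo_reg (- (l - m)) (l - m + 1) (1 - (- m))
      (complex_of_real ((1 - x) / 2)))"
    using assms by (intro continuous_on_hypergeo_reg continuous_intros) (auto simp del: of_real_divide)
  moreover have "0 < (1 - x) / (1 + x)" using assms by simp
  ultimately have "continuous_on (cball \<mu> 1) (\<lambda>m. ferrers_P (l - m) (- m) x)"
    unfolding ferrers_P_def by (simp only: powr_of_real_exp) (intro continuous_intros; simp)
  then have "continuous_on (ball \<mu> 1) (\<lambda>m. ferrers_P (l - m) (- m) x)"
    by (rule continuous_on_subset) (rule ball_subset_cball)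
  then show ?thesis
    by (simp add: continuous_on_eq_continuous_at)
qed

text \<open>Distinct integers are at distance at least 1, so the punctured unit ball around an
  excluded parameter contains no other one.\<close>

lemma eventually_shift_not_nonpos_Int:
  fixes \<mu> d :: "'a::{real_normed_algebra_1, ring_char_0}"
  assumes "\<mu> + d \<in> \<int>\<^sub>\<le>\<^sub>0"
  shows "eventually (\<lambda>m. m + d \<notin> \<int>\<^sub>\<le>\<^sub>0) (at \<mu>)"
proof -
  have "m + d \<notin> \<int>\<^sub>\<le>\<^sub>0" if "m \<noteq> \<mu>" "dist m \<mu> < 1" for m
  proof
    assume "m + d \<in> \<int>\<^sub>\<le>\<^sub>0"
    with assms obtain i j where "m + d = of_int i" "\<mu> + d = of_int j"
      by (meson nonpos_Ints_cases)
    moreover have "m - \<mu> = (m + d) - (\<mu> + d)" by simp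
    ultimately have eq: "m - \<mu> = of_int (i - j)" by (simp only: of_int_diff)
    with that have "\<bar>real_of_int (i - j)\<bar> < 1"
      by (metis dist_norm norm_of_int)
    then have "i - j = 0" by linarith
    with eq that show False by simp
  qed
  then show ?thesis
    by (auto simp: eventually_at intro!: exI[of _ 1])
qed

text \<open>Pfaff's transformation on the left and the duplication formula on the right lead to the
  same series \<open>H\<close>; what remains is a comparison of powers of 2, t and w.\<close>

lemma ferrers_P_expansion:
  fixes l \<mu> :: complex and x :: real
  assumes x: "0 < x" "x < 1" and \<mu>: "\<mu> + 1 / 2 \<notin> \<int>\<^sub>\<le>\<^sub>0"
  shows "ferrers_P (l - \<mu>) (- \<mu>) x =
           2 powr (3 * \<mu>) * Gamma (\<mu> + 1 / 2) /
             (complex_of_real (sqrt pi) * complex_of_real (1 - x\<^sup>2) powr (\<mu> / 2)) *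
           (\<Sum>n. (-1) ^ n * pochhammer (2 * \<mu> - l) (2 * n) * pochhammer (2 * \<mu>) n / fact n *
             ferrers_P l (- 2 * \<mu> - 2 * of_nat n) x)"
proof -
  define t where "t = (1 - x) / (1 + x)"
  define w where "w = (1 + x) / 2"
  have t: "0 < t" "t < 1" and w: "0 < w" using x by (auto simp: t_def w_def)
  have zt: "1 - (1 - x) / 2 = w" "(1 - x) / 2 / w = t"
    using x by (simp_all add: t_def w_def field_simps)
  have xtw: "1 - x\<^sup>2 = (2 * w)\<^sup>2 * t"
    using x by (simp add: t_def w_def field_simps power2_eq_square)
  define H where "H = hypergeo_reg (\<mu> - l) (2 * \<mu> - l) (1 + \<mu>) (- of_real t)"
  define \<kappa> where "\<kappa> = 2 powr (2 * \<mu>) * Gamma (\<mu> + 1 / 2)"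
  have \<kappa>: "\<kappa> \<noteq> 0" using \<mu> by (simp add: \<kappa>_def Gamma_eq_zero_iff)
  let ?X = "complex_of_real (1 - x\<^sup>2) powr (\<mu> / 2)"
  have X0: "?X \<noteq> 0"
    unfolding xtw using t w by simp
  have lhs: "ferrers_P (l - \<mu>) (- \<mu>) x = of_real t powr (\<mu> / 2) * of_real w powr (l - \<mu>) * H"
    using hypergeo_reg_pfaff[of "(1 - x) / 2" "- (l - \<mu>)" "l - \<mu> + 1" "1 - - \<mu>"] x
    unfolding zt by (simp add: ferrers_P_def H_def flip: t_def)
  have summand: "pochhammer (2 * \<mu> - l) N * pochhammer (\<mu> - l) N / fact N *
      (4 ^ N * pochhammer (\<mu> + 1 / 2) N * rGamma (1 + 2 * \<mu> + 2 * of_nat N)) * (- of_real t) ^ N =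
      of_real (sqrt pi) / \<kappa> * (pochhammer (\<mu> - l) N * pochhammer (2 * \<mu> - l) N *
        rGamma (1 + \<mu> + of_nat N) / fact N * (- of_real t) ^ N)" for N
  proof -
    have "4 ^ N * pochhammer (\<mu> + 1 / 2) N * rGamma (1 + 2 * \<mu> + 2 * of_nat N) =
        of_real (sqrt pi) / \<kappa> * rGamma (1 + \<mu> + of_nat N)"
      using rGamma_duplication_shift[OF \<mu>, of N] \<kappa>
      by (simp only: flip: \<kappa>_def) (simp add: field_simps)
    then show ?thesis by (simp only: mult_ac times_divide_eq_right times_divide_eq_left)
  qed
  have sum: "(\<Sum>n. (-1) ^ n * pochhammer (2 * \<mu> - l) (2 * n) * pochhammer (2 * \<mu>) n / fact n *
             ferrers_P l (- 2 * \<mu> - 2 * of_nat n) x) =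
      of_real t powr \<mu> * of_real w powr l * (of_real (sqrt pi) / \<kappa> * H)"
  proof -
    have "(\<Sum>N. of_real (sqrt pi) / \<kappa> * (pochhammer (\<mu> - l) N * pochhammer (2 * \<mu> - l) N *
        rGamma (1 + \<mu> + of_nat N) / fact N * (- of_real t) ^ N)) = of_real (sqrt pi) / \<kappa> * H"
      unfolding H_def hypergeo_reg_def
      by (rule suminf_mult, rule summable_hypergeo_reg) (use t in simp)
    then show ?thesis
      using ferrers_P_series_sums[OF x, of \<mu> l, folded t_def w_def] unfolding summand by (simp only: sums_iff)
  qed
  \<comment> \<open>By \<open>xtw\<close> the power of 1 - x^2 equals (2w)^\<mu> t^(\<mu>/2); with
    all bases positive, the claim reduces to adding logarithms.\<close>
  have "2 powr (3 * \<mu>) * (of_real t powr \<mu> * of_real w powr l) =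
      of_real t powr (\<mu> / 2) * of_real w powr (l - \<mu>) * (2 powr (2 * \<mu>) * ?X)"
  proof -
    have "ln ((2 * w)\<^sup>2 * t) = 2 * (ln 2 + ln w) + ln t"
      using t w by (subst ln_mult_pos, simp, simp, subst ln_realpow, simp) (simp add: ln_mult)
    then have "ln (1 - x\<^sup>2) = 2 * ln 2 + ln t + 2 * ln w"
      unfolding xtw by simp
    moreover have "0 < 1 - x\<^sup>2" unfolding xtw using t w by simp
    ultimately have X: "?X = exp (\<mu> / 2 * (2 * of_real (ln 2) + of_real (ln t) + 2 * of_real (ln w)))"
      by (simp only: powr_of_real_exp) simp
    have two: "2 powr v = exp (v * of_real (ln 2))" for v :: complex
      using powr_of_real_exp[of 2 v] by simp
    show ?thesis
      unfolding X two powr_of_real_exp[OF t(1)] powr_of_real_exp[OF w] exp_add[symmetric]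
      by (rule arg_cong[of _ _ exp]) (simp add: field_simps)
  qed
  then have pre: "2 powr (3 * \<mu>) * (of_real t powr \<mu> * of_real w powr l) / (2 powr (2 * \<mu>) * ?X) =
      of_real t powr (\<mu> / 2) * of_real w powr (l - \<mu>)"
    using X0 by (simp add: nonzero_divide_eq_eq)
  have "2 powr (3 * \<mu>) * Gamma (\<mu> + 1 / 2) / (of_real (sqrt pi) * ?X) *
      (of_real t powr \<mu> * of_real w powr l * (of_real (sqrt pi) / \<kappa> * H)) =
      2 powr (3 * \<mu>) * (of_real t powr \<mu> * of_real w powr l) / (2 powr (2 * \<mu>) * ?X) * H"
    using \<kappa> X0 by (simp add: \<kappa>_def mult_ac)
  then show ?thesis
    unfolding sum lhs pre by simp
qed

text \<open>Where \<Gamma>(\<mu> + 1/2) has a pole, the right-hand side is read as its limit in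
  \<mu>, since the value 0 of \<open>Gamma\<close> there would not express the identity. Summability
  is asserted separately, as \<open>suminf\<close> alone does not imply convergence.\<close>

theorem theorem19:
  fixes l \<mu> :: complex and x :: real
  assumes "0 < x" and "x < 1"
  shows "summable (\<lambda>n. (-1) ^ n * pochhammer (2 * \<mu> - l) (2 * n) * pochhammer (2 * \<mu>) n / fact n *
           ferrers_P l (- 2 * \<mu> - 2 * of_nat n) x) \<and>
         (\<mu> + 1 / 2 \<notin> \<int>\<^sub>\<le>\<^sub>0 \<longrightarrow>
         ferrers_P (l - \<mu>) (- \<mu>) x =
           2 powr (3 * \<mu>) * Gamma (\<mu> + 1 / 2) /
             (complex_of_real (sqrt pi) * complex_of_real (1 - x\<^sup>2) powr (\<mu> / 2)) *
           (\<Sum>n. (-1) ^ n * pochhammer (2 * \<mu> - l) (2 * n) * pochhammer (2 * \<mu>) n / fact n *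
             ferrers_P l (- 2 * \<mu> - 2 * of_nat n) x)) \<and>
         (\<mu> + 1 / 2 \<in> \<int>\<^sub>\<le>\<^sub>0 \<longrightarrow>
         ((\<lambda>m. 2 powr (3 * m) * Gamma (m + 1 / 2) /
             (complex_of_real (sqrt pi) * complex_of_real (1 - x\<^sup>2) powr (m / 2)) *
           (\<Sum>n. (-1) ^ n * pochhammer (2 * m - l) (2 * n) * pochhammer (2 * m) n / fact n *
             ferrers_P l (- 2 * m - 2 * of_nat n) x))
          \<longlongrightarrow> ferrers_P (l - \<mu>) (- \<mu>) x) (at \<mu>))"
proof (intro conjI impI)
  show "summable (\<lambda>n. (-1) ^ n * pochhammer (2 * \<mu> - l) (2 * n) * pochhammer (2 * \<mu>) n / fact n *
           ferrers_P l (- 2 * \<mu> - 2 * of_nat n) x)"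
    using ferrers_P_series_sums[OF assms, of \<mu> l] by (rule sums_summable)
  assume "\<mu> + 1 / 2 \<in> \<int>\<^sub>\<le>\<^sub>0"
  \<comment> \<open>The expansion holds at all nearby m \<noteq> \<mu>, so the limit is that of the
    left-hand side, which is continuous.\<close>
  then have "eventually (\<lambda>m. m + 1 / 2 \<notin> \<int>\<^sub>\<le>\<^sub>0) (at \<mu>)"
    by (rule eventually_shift_not_nonpos_Int)
  then have "eventually (\<lambda>m. ferrers_P (l - m) (- m) x = 2 powr (3 * m) * Gamma (m + 1 / 2) /
             (complex_of_real (sqrt pi) * complex_of_real (1 - x\<^sup>2) powr (m / 2)) *
           (\<Sum>n. (-1) ^ n * pochhammer (2 * m - l) (2 * n) * pochhammer (2 * m) n / fact n *
             ferrers_P l (- 2 * m - 2 * of_nat n) x)) (at \<mu>)"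
    by eventually_elim (rule ferrers_P_expansion[OF assms])
  moreover have "((\<lambda>m. ferrers_P (l - m) (- m) x) \<longlongrightarrow> ferrers_P (l - \<mu>) (- \<mu>) x) (at \<mu>)"
    using isCont_ferrers_P[OF assms] by (simp add: isCont_def)
  ultimately show "((\<lambda>m. 2 powr (3 * m) * Gamma (m + 1 / 2) /
             (complex_of_real (sqrt pi) * complex_of_real (1 - x\<^sup>2) powr (m / 2)) *
           (\<Sum>n. (-1) ^ n * pochhammer (2 * m - l) (2 * n) * pochhammer (2 * m) n / fact n *
             ferrers_P l (- 2 * m - 2 * of_nat n) x))
          \<longlongrightarrow> ferrers_P (l - \<mu>) (- \<mu>) x) (at \<mu>)"
    by (rule Lim_transform_eventually[rotated])
qed (rule ferrers_P_expansion[OF assms])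

end
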